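(* Let $K\ge2$. For $\mathbf p\in[0,1]^K$ define, with $\inf\varnothing=1$, $$F_{\mathrm{EA}}(\mathbf p)=\inf\left\{\alpha\in(0,1):\ \bigvee_{\ell\le K}\left(\frac1\ell\sum_{i=1}^\ell \left(2-2\frac{p_i}\alpha\right)_+\right)\ge1\right\},$$ $$F'_{\mathrm{EA}}(\mathbf p)=\inf\left\{\alpha\in(0,1):\ \bigvee_{\ell\le K}\left(\frac1\ell\sum_{i=1}^\ell\left(2-2\frac{p_i}\alpha\right)\right)\ge1\right\},\qquad F'_{\mathrm A}(\mathbf p)=2A(\mathbf p).$$ The dominations among ex-p-merging functions $F_{\mathrm{EA}}\le F'_{\mathrm{EA}}\le F'_{\mathrm A}$ are strict. Moreover, $$F'_{\mathrm{EA}}(\mathbf p)=2\left\{\bigwedge_{m=1}^KA(\mathbf p_m)\right\},\qquad F_{\mathrm{EA}}(\mathbf p)=\left(\bigwedge_{\ell=1}^K\bigwedge_{m=1}^\ell\frac{2A(\mathbf p^\ell_{(m)})}{(2-\ell/m)_+}\right)\mathbf 1\{p_{(1)}>0\}.$$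
   Context: $\bigvee,\bigwedge$ denote maximum and minimum; $x_+=\max(x,0)$; $\mathbf 1\{\cdot\}$ is the indicator; a fraction with denominator $0$ is read as $+\infty$. $A(\cdot)$ is the arithmetic mean of the components of a vector; $\mathbf p_m=(p_1,\dots,p_m)$; $p_{(1)}=\min_ip_i$; $\mathbf p^\ell_{(m)}$ is the vector of the $m$ smallest elements of $(p_1,\dots,p_\ell)$. Fix an atomless probability space (one supporting a random variable uniform on $[0,1]$); $\mathcal U^K$ is the set of all $K$-dimensional random vectors (arbitrary joint distribution) with components uniform on $[0,1]$; a vector is exchangeable if its law is invariant under permutations of components. An ex-p-merging function is an increasing (non-decreasing in each component) Borel function $F:[0,1]^K\to[0,1]$ with $\mathbb P(F(\mathbf P)\le\alpha)\le\alpha$ for all $\alpha\in(0,1)$ and all exchangeable $\mathbf P\in\mathcal U^K$. $F$ dominates $G$ if $F(\mathbf p)\le G(\mathbf p)$ for all $\mathbf p$, and the domination is strict if $F(\mathbf p)<G(\mathbf p)$ for at least one $\mathbf p$.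
   Formalization: Closed forms are truncated at 1, as is 2A as an ex-p-merging function. The F_EA formula fails at p=(1,1,0), so it is proved for p_(1)>0 or K=2, and for all p when the summand (2-2p_i/α)_+ is set to +∞ at p_i=0. *)

theory Defs
  imports "HOL-Probability.Probability" "HOL-Combinatorics.Permutations"
begin

text \<open>
  A vector \<open>(p\<^sub>1, \<dots>, p\<^sub>K)\<close> is a function on indices, extensional outside \<open>{1..K}\<close>.
  For such functions the pointwise order is the componentwise order of vectors.
\<close>

abbreviation cube :: "nat \<Rightarrow> (nat \<Rightarrow> real) set" where
  "cube K \<equiv> {1..K} \<rightarrow>\<^sub>E {0..1}"

abbreviation cube_algebra :: "nat \<Rightarrow> (nat \<Rightarrow> real) measure" where
  "cube_algebra K \<equiv> \<Pi>\<^sub>M i\<in>{1..K}. restrict_space borel {0..1}"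

definition uniform01 :: "'a measure \<Rightarrow> ('a \<Rightarrow> real) \<Rightarrow> bool" where
  "uniform01 M X \<longleftrightarrow> X \<in> borel_measurable M \<and> distr M borel X = uniform_measure lborel {0..1}"

definition atomless_prob_space :: "'a measure \<Rightarrow> bool" where
  "atomless_prob_space M \<longleftrightarrow> prob_space M \<and> (\<exists>U. uniform01 M U)"

definition uniform_vectors :: "'a measure \<Rightarrow> nat \<Rightarrow> ('a \<Rightarrow> nat \<Rightarrow> real) set" where
  "uniform_vectors M K =
     {P \<in> M \<rightarrow>\<^sub>M cube_algebra K. \<forall>i\<in>{1..K}. uniform01 M (\<lambda>\<omega>. P \<omega> i)}"

definition exchangeable :: "'a measure \<Rightarrow> nat \<Rightarrow> ('a \<Rightarrow> nat \<Rightarrow> real) \<Rightarrow> bool" where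
  "exchangeable M K P \<longleftrightarrow>
     (\<forall>\<pi>. \<pi> permutes {1..K} \<longrightarrow>
        distr M (cube_algebra K) (\<lambda>\<omega>. P \<omega> \<circ> \<pi>) = distr M (cube_algebra K) P)"

definition ex_p_merging :: "'a measure \<Rightarrow> nat \<Rightarrow> ((nat \<Rightarrow> real) \<Rightarrow> real) \<Rightarrow> bool" where
  "ex_p_merging M K F \<longleftrightarrow>
     F \<in> cube K \<rightarrow> {0..1} \<and>
     mono_on (cube K) F \<and>
     F \<in> borel_measurable (cube_algebra K) \<and>
     (\<forall>P\<in>uniform_vectors M K. exchangeable M K P \<longrightarrow>
        (\<forall>\<alpha>\<in>{0<..<1}. measure M {\<omega> \<in> space M. F (P \<omega>) \<le> \<alpha>} \<le> \<alpha>))"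

definition dominates :: "nat \<Rightarrow> ((nat \<Rightarrow> real) \<Rightarrow> real) \<Rightarrow> ((nat \<Rightarrow> real) \<Rightarrow> real) \<Rightarrow> bool" where
  "dominates K F G \<longleftrightarrow> (\<forall>p\<in>cube K. F p \<le> G p)"

definition strictly_dominates :: "nat \<Rightarrow> ((nat \<Rightarrow> real) \<Rightarrow> real) \<Rightarrow> ((nat \<Rightarrow> real) \<Rightarrow> real) \<Rightarrow> bool" where
  "strictly_dominates K F G \<longleftrightarrow> dominates K F G \<and> (\<exists>p\<in>cube K. F p < G p)"

definition amean :: "real list \<Rightarrow> real" where
  "amean xs = sum_list xs / real (length xs)"

definition prefix_vec :: "nat \<Rightarrow> (nat \<Rightarrow> real) \<Rightarrow> real list" where
  "prefix_vec m p = map p [1..<Suc m]"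

definition smallest_vec :: "nat \<Rightarrow> nat \<Rightarrow> (nat \<Rightarrow> real) \<Rightarrow> real list" where
  "smallest_vec l m p = take m (sort (prefix_vec l p))"

definition inf1 :: "real set \<Rightarrow> real" where
  "inf1 S = (if S = {} then 1 else Inf S)"

definition F_EA :: "nat \<Rightarrow> (nat \<Rightarrow> real) \<Rightarrow> real" where
  "F_EA K p = inf1 {\<alpha> \<in> {0<..<1}.
     (MAX l\<in>{1..K}. 1 / real l * (\<Sum>i=1..l. max (2 - 2 * (p i / \<alpha>)) 0)) \<ge> 1}"

definition F'_EA :: "nat \<Rightarrow> (nat \<Rightarrow> real) \<Rightarrow> real" where
  "F'_EA K p = inf1 {\<alpha> \<in> {0<..<1}.
     (MAX l\<in>{1..K}. 1 / real l * (\<Sum>i=1..l. 2 - 2 * (p i / \<alpha>))) \<ge> 1}"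

definition F'_A :: "nat \<Rightarrow> (nat \<Rightarrow> real) \<Rightarrow> real" where
  "F'_A K p = 2 * amean (prefix_vec K p)"

text \<open>
  The variant of \<^const>\<open>F_EA\<close> in which the calibrator \<open>x \<mapsto> (2 - 2 x)\<^sub>+\<close> takes the value
  \<open>\<infinity>\<close> at \<open>x = 0\<close>. The two functions agree when all components are positive, but not in
  general: at \<open>(1, 1, 0)\<close> the former is \<open>1\<close> and the latter \<open>0\<close>. The factor
  \<open>1{p\<^sub>(\<^sub>1\<^sub>) > 0}\<close> in the closed form below is correct at every point for this variant; for
  \<^const>\<open>F_EA\<close> it is so only when \<open>K = 2\<close>, and in general when all components are positive.
\<close>

definition F_EA_inf :: "nat \<Rightarrow> (nat \<Rightarrow> real) \<Rightarrow> real" where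
  "F_EA_inf K p = inf1 {\<alpha> \<in> {0<..<1}.
     (MAX l\<in>{1..K}. ereal (1 / real l) *
        (\<Sum>i=1..l. if p i = 0 then \<infinity> else ereal (max (2 - 2 * (p i / \<alpha>)) 0))) \<ge> 1}"

text \<open>
  The closed forms, and \<^const>\<open>F'_A\<close>, may exceed \<open>1\<close>; as functions into \<open>[0,1]\<close>
  they are truncated at \<open>1\<close>.
\<close>

definition trunc1 :: "((nat \<Rightarrow> real) \<Rightarrow> real) \<Rightarrow> (nat \<Rightarrow> real) \<Rightarrow> real" where
  "trunc1 F p = min 1 (F p)"

text \<open>Division with \<open>a / 0 = \<infinity>\<close> for every \<open>a\<close>, unlike division on \<^typ>\<open>ereal\<close>, where \<open>0 / 0 = 0\<close>.\<close>

definition div_inf :: "real \<Rightarrow> real \<Rightarrow> ereal" where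
  "div_inf a b = (if b = 0 then \<infinity> else ereal (a / b))"

definition EA_closed_form :: "nat \<Rightarrow> (nat \<Rightarrow> real) \<Rightarrow> ereal" where
  "EA_closed_form K p =
     (MIN l\<in>{1..K}. MIN m\<in>{1..l}.
        div_inf (2 * amean (smallest_vec l m p)) (max (2 - real l / real m) 0))
     * (if Min (p ` {1..K}) > 0 then 1 else 0)"

end

theory Submission
  imports Defs
begin

text \<open>
  Let \<open>l\<close> be the last index at which the partial sum of exchangeable non-negative
  variables reaches \<open>l\<close>. The event that this happens at \<open>l\<close> is symmetric in the first \<open>l\<close>
  variables, so on it their average may be replaced by the first variable inside the
  expectation; summing over \<open>l\<close> gives a Markov inequality for the maximum of the running averages.
  Applied to the calibrator \<open>x \<mapsto> (2 - 2 x / \<alpha>)\<^sub>+\<close>, whose integral over \<open>[0,1]\<close> is \<open>\<alpha>\<close>,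
  it makes every function in the theorem an ex-p-merging function. The closed form comes from
  the fact that a sum of positive parts is attained on an initial segment of the sorted vector.
\<close>

subsection \<open>The exchangeable Markov inequality\<close>

lemma space_PiM_restrict_borel [simp]:
  "space (\<Pi>\<^sub>M i\<in>I. restrict_space borel (A i)) = (\<Pi>\<^sub>E i\<in>I. A i)"
  by (simp add: space_PiM space_restrict_space)

lemma measurable_cube_component [measurable]:
  assumes "i \<in> {1..K}"
  shows "(\<lambda>p. p i) \<in> borel_measurable (cube_algebra K)"
proof -
  have "(\<lambda>p. p i) \<in> cube_algebra K \<rightarrow>\<^sub>M restrict_space borel {0..1::real}"
    using assms by (rule measurable_component_singleton)
  then show ?thesis by (simp add: measurable_restrict_space2_iff)
qed

lemma measurable_cube_permute:
  assumes "\<pi> permutes {1..K}"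
  shows "(\<lambda>p. p \<circ> \<pi>) \<in> cube_algebra K \<rightarrow>\<^sub>M cube_algebra K"
proof (rule measurable_PiM_single')
  fix i assume "i \<in> {1..K}"
  then have "\<pi> i \<in> {1..K}" using assms permutes_in_image by metis
  then show "(\<lambda>p. (p \<circ> \<pi>) i) \<in> cube_algebra K \<rightarrow>\<^sub>M restrict_space borel {0..1::real}"
    unfolding comp_def by (rule measurable_component_singleton)
next
  \<comment> \<open>Extensionality survives composition because \<open>\<pi>\<close> fixes every
    index outside \<open>{1..K}\<close>.\<close>
  show "(\<lambda>p. p \<circ> \<pi>) \<in> space (cube_algebra K) \<rightarrow> (\<Pi>\<^sub>E i\<in>{1..K}. space (restrict_space borel {0..1::real}))"
    using permutes_in_image[OF assms] permutes_not_in[OF assms]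
    by (auto simp: space_restrict_space PiE_iff extensional_def simp del: One_nat_def)
qed

lemma sum_transpose_prefix:
  fixes g :: "nat \<Rightarrow> 'b::comm_monoid_add"
  assumes "i \<in> {1..k}" "j \<in> {1..k}"
  shows "(\<Sum>n=1..k. g (Transposition.transpose i j n)) = (\<Sum>n=1..k. g n)"
  using sum.permute[OF permutes_swap_id[OF assms], of g] by (simp add: comp_def)

text \<open>Values in \<open>ennreal\<close> admit a calibrator that is infinite at a point and make
  integrability questions disappear. The thresholds are on sums rather than averages, which avoids
  division.\<close>

lemma exchangeable_Markov:
  fixes f :: "real \<Rightarrow> ennreal"
  assumes P[measurable]: "P \<in> M \<rightarrow>\<^sub>M cube_algebra K" and exch: "exchangeable M K P"
    and f[measurable]: "f \<in> borel_measurable borel" and K: "1 \<le> K"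
  shows "emeasure M {\<omega> \<in> space M. \<exists>l\<in>{1..K}. of_nat l \<le> (\<Sum>i=1..l. f (P \<omega> i))}
           \<le> (\<integral>\<^sup>+\<omega>. f (P \<omega> 1) \<partial>M)"
proof -
  define N where "N = distr M (cube_algebra K) P"
  have sN[simp, measurable_cong]: "sets N = sets (cube_algebra K)" by (simp add: N_def)
  have spN[simp]: "space N = cube K" using sets_eq_imp_space_eq[OF sN] by simp
  have m1[measurable]: "(\<lambda>p. f (p i)) \<in> borel_measurable (cube_algebra K)" if "i \<in> {1..K}" for i
    using measurable_compose[OF measurable_cube_component[OF that] f] .
  define S where "S l p = (\<Sum>i=1..l. f (p i))" for l and p :: "nat \<Rightarrow> real"
  have mS: "S l \<in> borel_measurable (cube_algebra K)" if "l \<in> {1..K}" for l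
    unfolding S_def using that by (intro borel_measurable_sum m1) auto
  \<comment> \<open>\<open>E l\<close> says that \<open>l\<close> is the last index at which the
    threshold is met. Looking for the last index, not the first, is essential: the condition
    involves only \<open>S k\<close> with \<open>k \<ge> l\<close>, and these are all symmetric in
    the first \<open>l\<close> components.\<close>
  define E where "E l = {p \<in> cube K. of_nat l \<le> S l p \<and> (\<forall>k\<in>{l<..K}. \<not> of_nat k \<le> S k p)}" for l
  have mge: "{p \<in> space (cube_algebra K). of_nat l \<le> S l p} \<in> sets (cube_algebra K)" if "l \<in> {1..K}" for l
    using mS[OF that] by measurable
  have mE[measurable]: "E l \<in> sets (cube_algebra K)" if "l \<in> {1..K}" for l
  proof -
    have "E l = {p \<in> space (cube_algebra K). of_nat l \<le> S l p}
        - (\<Union>k\<in>{l<..K}. {p \<in> space (cube_algebra K). of_nat k \<le> S k p})"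
      by (auto simp: E_def)
    also have "\<dots> \<in> sets (cube_algebra K)"
      using that by (intro sets.Diff sets.finite_UN mge) auto
    finally show ?thesis .
  qed
  \<comment> \<open>Transposing \<open>1\<close> and \<open>i\<close> preserves the law
    \<open>N\<close> by exchangeability, and the event \<open>E l\<close> because
    \<open>i \<le> l\<close>. A change of variables then moves \<open>f\<close> from one component
    to the other.\<close>
  have swap: "(\<integral>\<^sup>+p. f (p i) * indicator (E l) p \<partial>N) = (\<integral>\<^sup>+p. f (p 1) * indicator (E l) p \<partial>N)"
    if l: "l \<in> {1..K}" and i: "i \<in> {1..l}" for l i
  proof -
    define \<pi> where "\<pi> = Transposition.transpose 1 i"
    have perm: "\<pi> permutes {1..K}" unfolding \<pi>_def using l i by (intro permutes_swap_id) auto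
    have inv: "S k (p \<circ> \<pi>) = S k p" if "l \<le> k" for k p
      unfolding S_def \<pi>_def comp_def using sum_transpose_prefix[of 1 k i "\<lambda>n. f (p n)"] i that by auto
    have Einv: "p \<circ> \<pi> \<in> E l \<longleftrightarrow> p \<in> E l" if "p \<in> cube K" for p
    proof -
      have "p \<circ> \<pi> \<in> cube K"
        using measurable_space[OF measurable_cube_permute[OF perm], of p] that by simp
      then show ?thesis using that inv by (auto simp: E_def)
    qed
    have Nperm: "distr N (cube_algebra K) (\<lambda>p. p \<circ> \<pi>) = N"
      unfolding N_def distr_distr[OF measurable_cube_permute[OF perm] P]
      using exch perm by (simp add: exchangeable_def comp_def del: One_nat_def)
    have m: "(\<lambda>p. f (p 1) * indicator (E l) p) \<in> borel_measurable (cube_algebra K)"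
      using l K by (intro borel_measurable_times_ennreal m1 borel_measurable_indicator mE) auto
    have "(\<integral>\<^sup>+p. f (p 1) * indicator (E l) p \<partial>N)
        = (\<integral>\<^sup>+p. f (p 1) * indicator (E l) p \<partial>distr N (cube_algebra K) (\<lambda>p. p \<circ> \<pi>))"
      by (simp only: Nperm)
    also have "\<dots> = (\<integral>\<^sup>+p. f ((p \<circ> \<pi>) 1) * indicator (E l) (p \<circ> \<pi>) \<partial>N)"
      using measurable_cube_permute[OF perm] m
      by (subst nn_integral_distr) (auto simp: N_def)
    also have "\<dots> = (\<integral>\<^sup>+p. f (p i) * indicator (E l) p \<partial>N)"
      by (intro nn_integral_cong) (use Einv in \<open>auto simp: \<pi>_def indicator_def\<close>)
    finally show ?thesis by simp
  qed
  \<comment> \<open>On \<open>E l\<close> the integrand \<open>S l\<close> is at least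
    \<open>l\<close>; by \<open>swap\<close> its \<open>l\<close> summands have equal integrals over
    \<open>E l\<close>, and the positive finite factor \<open>l\<close> cancels.\<close>
  have El: "emeasure N (E l) \<le> (\<integral>\<^sup>+p. f (p 1) * indicator (E l) p \<partial>N)" if l: "l \<in> {1..K}" for l
  proof -
    have "of_nat l * emeasure N (E l) = (\<integral>\<^sup>+p. of_nat l * indicator (E l) p \<partial>N)"
      using mE[OF l] by (intro nn_integral_cmult_indicator[symmetric]) simp
    also have "\<dots> \<le> (\<integral>\<^sup>+p. (\<Sum>i=1..l. f (p i) * indicator (E l) p) \<partial>N)"
      by (intro nn_integral_mono) (auto simp: E_def S_def indicator_def)
    also have "\<dots> = (\<Sum>i=1..l. \<integral>\<^sup>+p. f (p i) * indicator (E l) p \<partial>N)"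
      using l mE[OF l] by (intro nn_integral_sum) (auto intro!: borel_measurable_times_ennreal m1)
    also have "\<dots> = (\<Sum>i=1..l. \<integral>\<^sup>+p. f (p 1) * indicator (E l) p \<partial>N)"
      by (intro sum.cong refl swap l)
    also have "\<dots> = of_nat l * (\<integral>\<^sup>+p. f (p 1) * indicator (E l) p \<partial>N)"
      by simp
    finally show ?thesis using l by (subst (asm) ennreal_mult_le_mult_iff) auto
  qed
  let ?B = "{p \<in> cube K. \<exists>l\<in>{1..K}. of_nat l \<le> S l p}"
  have sub: "?B \<subseteq> (\<Union>l\<in>{1..K}. E l)"
  proof
    fix p assume p: "p \<in> ?B"
    define L where "L = {l\<in>{1..K}. of_nat l \<le> S l p}"
    have L: "finite L" "L \<noteq> {}" using p by (auto simp: L_def)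
    have max: "Max L \<in> {1..K}" "of_nat (Max L) \<le> S (Max L) p"
      using Max_in[OF L] unfolding eqset_imp_iff[OF L_def] by blast+
    have "\<not> of_nat k \<le> S k p" if "k \<in> {Max L<..K}" for k
    proof
      assume "of_nat k \<le> S k p"
      then have "k \<in> L" using that max by (simp add: L_def)
      then show False using Max_ge[OF L(1), of k] that by simp
    qed
    then have "p \<in> E (Max L)" using p max(2) by (simp add: E_def)
    then show "p \<in> (\<Union>l\<in>{1..K}. E l)" using max(1) by (rule UN_I[rotated])
  qed
  \<comment> \<open>The last index is unique, so the events \<open>E l\<close> are disjoint and the
    integrals of \<open>f (p 1)\<close> over them add up to at most the full integral.\<close>
  have disj: "(\<Sum>l=1..K. indicator (E l) p) \<le> (1::ennreal)" for p
  proof (cases "\<exists>l\<in>{1..K}. p \<in> E l")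
    case True
    then obtain l where l: "l \<in> {1..K}" "p \<in> E l" by blast
    have uniq: "k = l" if "k \<in> {1..K}" "p \<in> E k" for k
    proof (cases k l rule: linorder_cases)
      case less
      then show ?thesis using that(2) l by (simp add: E_def)
    next
      case greater
      then show ?thesis using that l(2) by (simp add: E_def)
    qed
    have "(\<Sum>l=1..K. indicator (E l) p) = (\<Sum>k\<in>{l}. indicator (E k) p :: ennreal)"
    proof (intro sum.mono_neutral_right ballI)
      show "indicator (E k) p = (0::ennreal)" if "k \<in> {1..K} - {l}" for k
        using uniq[of k] that by (cases "p \<in> E k") auto
    qed (use l in auto)
    then show ?thesis using l(2) by simp
  next
    case False
    then have "(\<Sum>l=1..K. indicator (E l) p) = (0::ennreal)"
      by (intro sum.neutral) (auto simp: indicator_def)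
    then show ?thesis by simp
  qed
  have Bs: "?B \<in> sets (cube_algebra K)"
  proof -
    have "?B = (\<Union>l\<in>{1..K}. {p \<in> space (cube_algebra K). of_nat l \<le> S l p})" by auto
    also have "\<dots> \<in> sets (cube_algebra K)" by (intro sets.finite_UN mge) auto
    finally show ?thesis .
  qed
  have pre: "P -` ?B \<inter> space M = {\<omega> \<in> space M. \<exists>l\<in>{1..K}. of_nat l \<le> (\<Sum>i=1..l. f (P \<omega> i))}"
    using measurable_space[OF P] by (auto simp: S_def)
  have "emeasure M {\<omega> \<in> space M. \<exists>l\<in>{1..K}. of_nat l \<le> (\<Sum>i=1..l. f (P \<omega> i))} = emeasure N ?B"
    unfolding N_def pre[symmetric] using Bs P by (simp add: emeasure_distr)
  also have "\<dots> \<le> emeasure N (\<Union>l\<in>{1..K}. E l)"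
    by (intro emeasure_mono sub) (use mE in auto)
  also have "\<dots> \<le> (\<Sum>l=1..K. emeasure N (E l))"
    by (intro emeasure_subadditive_finite) (use mE in auto)
  also have "\<dots> \<le> (\<Sum>l=1..K. \<integral>\<^sup>+p. f (p 1) * indicator (E l) p \<partial>N)"
    by (intro sum_mono El)
  also have "\<dots> = (\<integral>\<^sup>+p. (\<Sum>l=1..K. f (p 1) * indicator (E l) p) \<partial>N)"
    using K mE by (intro nn_integral_sum[symmetric]) (auto intro!: borel_measurable_times_ennreal m1)
  also have "\<dots> \<le> (\<integral>\<^sup>+p. f (p 1) \<partial>N)"
  proof (intro nn_integral_mono)
    fix p :: "nat \<Rightarrow> real"
    show "(\<Sum>l=1..K. f (p 1) * indicator (E l) p) \<le> f (p 1)"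
      using mult_left_mono[OF disj[of p], of "f (p 1)"] by (simp add: sum_distrib_left)
  qed
  also have "\<dots> = (\<integral>\<^sup>+\<omega>. f (P \<omega> 1) \<partial>M)"
    unfolding N_def using K by (intro nn_integral_distr P m1) (simp del: One_nat_def)
  finally show ?thesis .
qed

text \<open>
  The coercion to \<^typ>\<open>ennreal\<close> takes the positive part, and the value at \<open>0\<close>, irrelevant
  for the integral, lets one bound serve both conventions for vanishing components.
\<close>

definition calib :: "real \<Rightarrow> real \<Rightarrow> ennreal" where
  "calib \<alpha> x = (if x = 0 then \<infinity> else ennreal (2 - 2 * (x / \<alpha>)))"

text \<open>Beyond \<open>\<alpha>\<close> the calibrator vanishes; on \<open>[0, \<alpha>]\<close>
  its antiderivative \<open>2 x - x^2 / \<alpha>\<close> grows from \<open>0\<close> to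
  \<open>\<alpha>\<close>.\<close>

lemma nn_integral_calib:
  assumes U: "uniform01 M U" and \<alpha>: "\<alpha> \<in> {0<..<1}"
  shows "(\<integral>\<^sup>+\<omega>. calib \<alpha> (U \<omega>) \<partial>M) = ennreal \<alpha>"
proof -
  have [measurable]: "U \<in> borel_measurable M" "calib \<alpha> \<in> borel_measurable borel"
    using U by (auto simp: uniform01_def calib_def[abs_def])
  have "(\<integral>\<^sup>+\<omega>. calib \<alpha> (U \<omega>) \<partial>M) = (\<integral>\<^sup>+x. calib \<alpha> x \<partial>distr M borel U)"
    by (simp add: nn_integral_distr)
  also have "\<dots> = (\<integral>\<^sup>+x. calib \<alpha> x * indicator {0..1} x \<partial>lborel)"
    using U by (simp add: uniform01_def nn_integral_uniform_measure divide_ennreal_def)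
  also have "\<dots> = (\<integral>\<^sup>+x. ennreal (2 - 2 * (x / \<alpha>)) * indicator {0..\<alpha>} x \<partial>lborel)"
  proof (rule nn_integral_cong_AE)
    \<comment> \<open>The infinite value at \<open>0\<close> sits on a null set and leaves the
      integral unchanged.\<close>
    have "AE x in lborel. x \<noteq> (0::real)" by (rule AE_lborel_singleton)
    then show "AE x in lborel. calib \<alpha> x * indicator {0..1} x
        = ennreal (2 - 2 * (x / \<alpha>)) * indicator {0..\<alpha>} x"
      by eventually_elim
        (use \<alpha> in \<open>auto simp: calib_def indicator_def ennreal_neg field_simps\<close>)
  qed
  also have "\<dots> = ennreal ((2 * \<alpha> - \<alpha>\<^sup>2 / \<alpha>) - (2 * 0 - 0\<^sup>2 / \<alpha>))"
  proof (rule nn_integral_FTC_Icc)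
    show "((\<lambda>x. 2 * x - x\<^sup>2 / \<alpha>) has_real_derivative 2 - 2 * (x / \<alpha>)) (at x)" for x
      using \<alpha> by (auto intro!: derivative_eq_intros simp: field_simps)
  qed (use \<alpha> in \<open>auto simp: field_simps\<close>)
  also have "\<dots> = ennreal \<alpha>" using \<alpha> by (simp add: power2_eq_square)
  finally show ?thesis .
qed

subsection \<open>Merging functions given by thresholds\<close>

text \<open>The truncation at \<open>1\<close> comes from the default value of \<open>inf1\<close>:
  for \<open>c \<ge> 1\<close>, including \<open>c = \<infinity>\<close>, no level is admissible.
  Extended values of \<open>c\<close> are allowed for the sake of the closed form with infinite
  quotients.\<close>

lemma ereal_inf1_ge:
  fixes c :: ereal
  assumes "0 \<le> c"
  shows "ereal (inf1 {\<alpha> \<in> {0<..<1}. c \<le> ereal \<alpha>}) = min 1 c"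
proof (cases c)
  case (real r)
  then have r: "0 \<le> r" using assms by simp
  show ?thesis
  proof (cases "r < 1")
    case True
    let ?S = "{\<alpha> \<in> {0<..<1}. c \<le> ereal \<alpha>}"
    \<comment> \<open>The midpoint of \<open>r\<close> and \<open>1\<close> lies in the open
      interval even when \<open>r = 0\<close>, where \<open>r\<close> itself is not an admissible
      level.\<close>
    have "(r + 1) / 2 \<in> ?S" using r True real by auto
    then have ne: "?S \<noteq> {}" by blast
    have "Inf ?S = r"
    proof (rule cInf_eq_non_empty[OF ne])
      show "r \<le> x" if "x \<in> ?S" for x using that real by simp
    next
      fix y assume y: "\<And>x. x \<in> ?S \<Longrightarrow> y \<le> x"
      show "y \<le> r"
      proof (rule dense_ge_bounded[OF True])
        fix w assume "r < w" "w < 1"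
        then show "y \<le> w" using r real by (intro y) auto
      qed
    qed
    then show ?thesis using ne True real by (simp add: inf1_def min_def)
  next
    case False
    then have "{\<alpha> \<in> {0<..<1}. c \<le> ereal \<alpha>} = {}" using real by auto
    then show ?thesis using False real by (simp add: inf1_def min_def)
  qed
next
  case PInf
  then show ?thesis by (simp add: inf1_def)
qed (use assms in auto)

lemma inf1_ge:
  assumes "0 \<le> c"
  shows "inf1 {\<alpha> \<in> {0<..<1}. c \<le> \<alpha>} = min 1 c"
proof -
  have "ereal (inf1 {\<alpha> \<in> {0<..<1}. c \<le> \<alpha>}) = min (ereal 1) (ereal c)"
    using ereal_inf1_ge[of "ereal c"] assms by (simp add: one_ereal_def)
  then show ?thesis by (simp add: min_def split: if_splits)
qed

text \<open>The bound \<open>a \<le> 1\<close> keeps the default value \<open>1\<close> of an empty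
  set from counting as less than \<open>a\<close>.\<close>

lemma inf1_less_iff:
  assumes "S \<subseteq> {0<..<1}" "a \<le> 1"
  shows "inf1 S < a \<longleftrightarrow> (\<exists>\<alpha>\<in>S. \<alpha> < a)"
proof (cases "S = {}")
  case False
  have "bdd_below S" using assms by (intro bdd_belowI[of _ 0]) auto
  then show ?thesis using False by (simp add: inf1_def cInf_less_iff)
qed (use assms in \<open>auto simp: inf1_def\<close>)

lemma inf1_bounds:
  assumes "S \<subseteq> {0<..<1}"
  shows "inf1 S \<in> {0..1}"
proof (cases "S = {}")
  case False
  then obtain x where x: "x \<in> S" by blast
  have "Inf S \<le> x" using assms x by (intro cInf_lower bdd_belowI[of _ 0]) auto
  moreover have "0 \<le> Inf S" using assms False by (intro cInf_greatest) auto
  ultimately show ?thesis using False assms x by (force simp: inf1_def)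
qed (simp add: inf1_def)

lemma inf1_antimono:
  assumes "S \<subseteq> T" "T \<subseteq> {0<..<1}"
  shows "inf1 T \<le> inf1 S"
proof (cases "S = {}")
  case False
  then have "T \<noteq> {}" "bdd_below T" using assms by (auto intro!: bdd_belowI[of _ 0])
  then show ?thesis using False assms by (simp add: inf1_def cInf_superset_mono)
next
  case True
  then show ?thesis using inf1_bounds[OF assms(2)] by (simp add: inf1_def)
qed

lemma cube_nonneg: "p \<in> cube K \<Longrightarrow> i \<in> {1..K} \<Longrightarrow> 0 \<le> p i"
  by (auto simp: PiE_iff)

text \<open>One argument for all the functions: \<open>Q \<alpha> p\<close> is read as rejection at
  level \<open>\<alpha>\<close>. The first condition makes rejection persist for smaller vectors and
  larger levels; the third embeds it in the event bounded by \<open>exchangeable_Markov\<close>,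
  whose bound is \<open>\<alpha>\<close> by \<open>nn_integral_calib\<close>.\<close>

lemma ex_p_merging_threshold:
  fixes Q :: "real \<Rightarrow> (nat \<Rightarrow> real) \<Rightarrow> bool"
  assumes M: "prob_space M" and K: "1 \<le> K"
    and mono: "\<And>p q \<alpha> \<beta>. (\<And>i. i \<in> {1..K} \<Longrightarrow> 0 \<le> p i) \<Longrightarrow> (\<And>i. i \<in> {1..K} \<Longrightarrow> p i \<le> q i) \<Longrightarrow>
      0 < \<alpha> \<Longrightarrow> \<alpha> \<le> \<beta> \<Longrightarrow> Q \<alpha> q \<Longrightarrow> Q \<beta> p"
    and meas: "\<And>\<alpha>. \<alpha> \<in> {0<..<1} \<Longrightarrow> {p \<in> space (cube_algebra K). Q \<alpha> p} \<in> sets (cube_algebra K)"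
    and calib: "\<And>p \<alpha>. p \<in> cube K \<Longrightarrow> \<alpha> \<in> {0<..<1} \<Longrightarrow> Q \<alpha> p \<Longrightarrow>
      \<exists>l\<in>{1..K}. of_nat l \<le> (\<Sum>i=1..l. calib \<alpha> (p i))"
    and F: "\<And>p. p \<in> cube K \<Longrightarrow> F p = inf1 {\<alpha> \<in> {0<..<1}. Q \<alpha> p}"
  shows "ex_p_merging M K F"
  unfolding ex_p_merging_def
proof (intro conjI ballI impI)
  interpret prob_space M by (fact M)
  have up: "Q \<beta> p" if "p \<in> cube K" "0 < \<alpha>" "\<alpha> \<le> \<beta>" "Q \<alpha> p" for p \<alpha> \<beta>
    using that(2-) by (intro mono[of p p \<alpha> \<beta>] cube_nonneg[OF that(1)]) auto
  show "F \<in> cube K \<rightarrow> {0..1}"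
  proof
    fix p assume "p \<in> cube K"
    then show "F p \<in> {0..1}" unfolding F[OF \<open>p \<in> cube K\<close>] by (intro inf1_bounds) auto
  qed
  show "mono_on (cube K) F"
  proof (rule mono_onI)
    fix p q assume pq: "p \<in> cube K" "q \<in> cube K" "p \<le> q"
    have "Q \<alpha> p" if "0 < \<alpha>" "Q \<alpha> q" for \<alpha>
      using that pq(3) by (intro mono[of p q \<alpha> \<alpha>] cube_nonneg[OF pq(1)]) (auto simp: le_fun_def)
    then have "{\<alpha> \<in> {0<..<1}. Q \<alpha> q} \<subseteq> {\<alpha> \<in> {0<..<1}. Q \<alpha> p}" by auto
    then show "F p \<le> F q" unfolding F[OF pq(1)] F[OF pq(2)] by (rule inf1_antimono) auto
  qed
  \<comment> \<open>Since \<open>Q\<close> is upward closed in the level, a rational level can be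
    inserted below \<open>a\<close>. Each sublevel set thus becomes a countable union of measurable
    rejection events.\<close>
  have below: "F p < a \<longleftrightarrow> (\<exists>q\<in>\<rat>. 0 < q \<and> q < a \<and> Q q p)" if p: "p \<in> cube K" and a: "a \<le> 1" for p a
  proof -
    have "F p < a \<longleftrightarrow> (\<exists>\<alpha>\<in>{\<alpha>\<in>{0<..<1}. Q \<alpha> p}. \<alpha> < a)"
      unfolding F[OF p] by (rule inf1_less_iff) (use a in auto)
    also have "\<dots> \<longleftrightarrow> (\<exists>q\<in>\<rat>. 0 < q \<and> q < a \<and> Q q p)"
    proof
      assume "\<exists>\<alpha>\<in>{\<alpha>\<in>{0<..<1}. Q \<alpha> p}. \<alpha> < a"
      then obtain \<alpha> where \<alpha>: "\<alpha> \<in> {0<..<1}" "Q \<alpha> p" "\<alpha> < a" by blast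
      obtain q where "q \<in> \<rat>" "\<alpha> < q" "q < a" using Rats_dense_in_real[OF \<alpha>(3)] by blast
      then show "\<exists>q\<in>\<rat>. 0 < q \<and> q < a \<and> Q q p"
        using up[OF p, of \<alpha> q] \<alpha> a by (intro bexI[of _ q]) auto
    qed (use a in force)
    finally show ?thesis .
  qed
  show "F \<in> borel_measurable (cube_algebra K)"
  proof (rule borel_measurable_iff_less[THEN iffD2], intro allI)
    fix a :: real
    show "{p \<in> space (cube_algebra K). F p < a} \<in> sets (cube_algebra K)"
    proof (cases "a \<le> 1")
      case True
      have "{p \<in> space (cube_algebra K). F p < a}
          = (\<Union>q\<in>\<rat> \<inter> {0<..<a}. {p \<in> space (cube_algebra K). Q q p})"
        using below[OF _ True] by (auto simp: Bex_def simp del: One_nat_def)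
      also have "\<dots> \<in> sets (cube_algebra K)"
        using True by (intro sets.countable_UN'' meas countable_Int1 countable_rat) auto
      finally show ?thesis .
    next
      case False
      have "F p < a" if "p \<in> cube K" for p
      proof -
        have "F p \<in> {0..1}" unfolding F[OF that] by (intro inf1_bounds) auto
        then show ?thesis using False by auto
      qed
      then have "{p \<in> space (cube_algebra K). F p < a} = space (cube_algebra K)" by auto
      then show ?thesis by (metis sets.top)
    qed
  qed
  fix P \<alpha>
  assume P: "P \<in> uniform_vectors M K" and exch: "exchangeable M K P" and \<alpha>: "\<alpha> \<in> {0<..<1::real}"
  have Pm[measurable]: "P \<in> M \<rightarrow>\<^sub>M cube_algebra K" and U: "uniform01 M (\<lambda>\<omega>. P \<omega> 1)"
    using P K by (auto simp: uniform_vectors_def)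
  have [measurable]: "calib \<beta> \<in> borel_measurable borel" for \<beta>
    unfolding calib_def[abs_def] by measurable
  have mP[measurable]: "(\<lambda>\<omega>. calib \<beta> (P \<omega> i)) \<in> borel_measurable M" if "i \<in> {1..K}" for i \<beta>
    using measurable_compose[OF Pm measurable_cube_component[OF that]] by simp
  \<comment> \<open>The infimum defining \<open>F\<close> may not be attained, so
    \<open>F (P \<omega>) \<le> \<alpha>\<close> yields rejection only at each level
    \<open>\<beta> > \<alpha>\<close>. The bound \<open>\<beta>\<close> holds for all such
    \<open>\<beta> < 1\<close>, and \<open>\<beta>\<close> then decreases to
    \<open>\<alpha>\<close>.\<close>
  show "measure M {\<omega> \<in> space M. F (P \<omega>) \<le> \<alpha>} \<le> \<alpha>"
  proof (rule dense_ge_bounded[of \<alpha> 1])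
    show "\<alpha> < 1" using \<alpha> by simp
    fix \<beta> assume \<beta>: "\<alpha> < \<beta>" "\<beta> < 1"
    have \<beta>': "\<beta> \<in> {0<..<1}" using \<alpha> \<beta> by auto
    let ?B = "{\<omega> \<in> space M. \<exists>l\<in>{1..K}. of_nat l \<le> (\<Sum>i=1..l. calib \<beta> (P \<omega> i))}"
    have B: "?B \<in> sets M"
    proof -
      have "{\<omega> \<in> space M. of_nat l \<le> (\<Sum>i=1..l. calib \<beta> (P \<omega> i))} \<in> sets M" if "l \<in> {1..K}" for l
        using that by (intro borel_measurable_le borel_measurable_sum mP) auto
      then have "(\<Union>l\<in>{1..K}. {\<omega> \<in> space M. of_nat l \<le> (\<Sum>i=1..l. calib \<beta> (P \<omega> i))}) \<in> sets M"
        by (intro sets.finite_UN) auto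
      also have "(\<Union>l\<in>{1..K}. {\<omega> \<in> space M. of_nat l \<le> (\<Sum>i=1..l. calib \<beta> (P \<omega> i))}) = ?B" by auto
      finally show ?thesis .
    qed
    have "{\<omega> \<in> space M. F (P \<omega>) \<le> \<alpha>} \<subseteq> ?B"
    proof safe
      fix \<omega> assume \<omega>: "\<omega> \<in> space M" and le: "F (P \<omega>) \<le> \<alpha>"
      have p: "P \<omega> \<in> cube K" using measurable_space[OF Pm \<omega>] by simp
      obtain q where "0 < q" "q < \<beta>" "Q q (P \<omega>)"
        using below[OF p, of \<beta>] le \<beta> by auto
      then have "Q \<beta> (P \<omega>)" using up[OF p, of q \<beta>] \<beta> by auto
      then show "\<exists>l\<in>{1..K}. of_nat l \<le> (\<Sum>i=1..l. calib \<beta> (P \<omega> i))" by (rule calib[OF p \<beta>'])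
    qed
    then have "measure M {\<omega> \<in> space M. F (P \<omega>) \<le> \<alpha>} \<le> measure M ?B"
      by (intro finite_measure_mono B)
    also have "emeasure M ?B \<le> ennreal \<beta>"
      using exchangeable_Markov[OF Pm exch _ K, of "calib \<beta>"] nn_integral_calib[OF U \<beta>'] by simp
    then have "measure M ?B \<le> \<beta>" using \<beta>' by (simp add: emeasure_eq_measure)
    finally show "measure M {\<omega> \<in> space M. F (P \<omega>) \<le> \<alpha>} \<le> \<beta>" .
  qed
qed

section \<open>Calibrator sums and threshold forms of the functions\<close>

text \<open>\<open>calib\<close> agrees with the positive part away from \<open>0\<close> and is
  infinite at \<open>0\<close>, so it majorizes the calibrator of \<open>F_EA\<close>.\<close>

lemma of_nat_le_sum_calib:
  assumes "real l \<le> (\<Sum>i=1..l. max (2 - 2 * (p i / \<alpha>)) 0)"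
  shows "of_nat l \<le> (\<Sum>i=1..l. calib \<alpha> (p i))"
proof -
  have "of_nat l \<le> ennreal (\<Sum>i=1..l. max (2 - 2 * (p i / \<alpha>)) 0)"
    using ennreal_leI[OF assms] by (simp add: ennreal_of_nat_eq_real_of_nat)
  also have "\<dots> = (\<Sum>i=1..l. ennreal (max (2 - 2 * (p i / \<alpha>)) 0))"
    by (intro sum_ennreal[symmetric]) auto
  also have "\<dots> \<le> (\<Sum>i=1..l. calib \<alpha> (p i))"
    by (intro sum_mono) (auto simp: calib_def max_def ennreal_neg)
  finally show ?thesis .
qed

lemma sum_calib_zero:
  fixes p :: "nat \<Rightarrow> real"
  assumes "i \<in> {1..l}" "p i = 0"
  shows "(\<Sum>i=1..l. calib \<alpha> (p i)) = \<infinity>"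
proof -
  have "calib \<alpha> (p i) \<le> (\<Sum>i=1..l. calib \<alpha> (p i))"
    using assms(1) by (intro member_le_sum) auto
  then show ?thesis using assms(2) by (simp add: calib_def top_unique)
qed

lemma calibrator_mono:
  fixes x y \<alpha> \<beta> :: real
  assumes "0 < \<alpha>" "\<alpha> \<le> \<beta>" "0 \<le> x" "x \<le> y"
  shows "2 - 2 * (y / \<alpha>) \<le> 2 - 2 * (x / \<beta>)"
  using frac_le[of y x \<alpha> \<beta>] assms by simp

lemma calibrator_sum_mono:
  fixes p q :: "nat \<Rightarrow> real"
  assumes l: "l \<in> {1..K}" and "0 < \<alpha>" "\<alpha> \<le> \<beta>"
    and "\<And>i. i \<in> {1..K} \<Longrightarrow> 0 \<le> p i" "\<And>i. i \<in> {1..K} \<Longrightarrow> p i \<le> q i"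
  shows "c \<le> (\<Sum>i=1..l. 2 - 2 * (q i / \<alpha>)) \<Longrightarrow> c \<le> (\<Sum>i=1..l. 2 - 2 * (p i / \<beta>))"
    and "c \<le> (\<Sum>i=1..l. max (2 - 2 * (q i / \<alpha>)) 0) \<Longrightarrow> c \<le> (\<Sum>i=1..l. max (2 - 2 * (p i / \<beta>)) 0)"
proof -
  have *: "2 - 2 * (q i / \<alpha>) \<le> 2 - 2 * (p i / \<beta>)" if "i \<in> {1..l}" for i
    using that l by (intro calibrator_mono assms) auto
  show "c \<le> (\<Sum>i=1..l. 2 - 2 * (q i / \<alpha>)) \<Longrightarrow> c \<le> (\<Sum>i=1..l. 2 - 2 * (p i / \<beta>))"
    by (erule order_trans, intro sum_mono *)
  show "c \<le> (\<Sum>i=1..l. max (2 - 2 * (q i / \<alpha>)) 0) \<Longrightarrow> c \<le> (\<Sum>i=1..l. max (2 - 2 * (p i / \<beta>)) 0)"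
    by (erule order_trans, intro sum_mono max.mono * order_refl)
qed

lemma MAX_average_ge_1_iff:
  fixes g :: "nat \<Rightarrow> real"
  assumes "1 \<le> K"
  shows "1 \<le> (MAX l\<in>{1..K}. 1 / real l * g l) \<longleftrightarrow> (\<exists>l\<in>{1..K}. real l \<le> g l)"
  using assms by (subst Max_ge_iff) (auto simp: field_simps)

lemma F_EA_eq:
  assumes "1 \<le> K"
  shows "F_EA K p = inf1 {\<alpha> \<in> {0<..<1}.
    \<exists>l\<in>{1..K}. real l \<le> (\<Sum>i=1..l. max (2 - 2 * (p i / \<alpha>)) 0)}"
  unfolding F_EA_def MAX_average_ge_1_iff[OF assms] ..

lemma F'_EA_eq:
  assumes "1 \<le> K"
  shows "F'_EA K p = inf1 {\<alpha> \<in> {0<..<1}. \<exists>l\<in>{1..K}. real l \<le> (\<Sum>i=1..l. 2 - 2 * (p i / \<alpha>))}"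
  unfolding F'_EA_def MAX_average_ge_1_iff[OF assms] ..

text \<open>A vanishing component makes the extended sum infinite, and its average passes the
  threshold at every level. Splitting off this case leaves a condition on real sums only.\<close>

lemma F_EA_inf_eq:
  assumes "1 \<le> K"
  shows "F_EA_inf K p = inf1 {\<alpha> \<in> {0<..<1}. \<exists>l\<in>{1..K}.
    (\<exists>i\<in>{1..l}. p i = 0) \<or> real l \<le> (\<Sum>i=1..l. max (2 - 2 * (p i / \<alpha>)) 0)}"
proof -
  have *: "1 \<le> ereal (1 / real l) * (\<Sum>i=1..l. if p i = 0 then \<infinity> else ereal (max (2 - 2 * (p i / \<alpha>)) 0))
     \<longleftrightarrow> (\<exists>i\<in>{1..l}. p i = 0) \<or> real l \<le> (\<Sum>i=1..l. max (2 - 2 * (p i / \<alpha>)) 0)"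
    (is "1 \<le> _ * ?T \<longleftrightarrow> _") if l: "l \<in> {1..K}" for l \<alpha>
  proof (cases "\<exists>i\<in>{1..l}. p i = 0")
    case True
    then have "?T = \<infinity>" by (subst sum_Pinfty) auto
    then show ?thesis using True l by simp
  next
    case False
    then have "?T = (\<Sum>i=1..l. ereal (max (2 - 2 * (p i / \<alpha>)) 0))"
      by (intro sum.cong) auto
    also have "\<dots> = ereal (\<Sum>i=1..l. max (2 - 2 * (p i / \<alpha>)) 0)" by (rule sum_ereal)
    finally have "1 \<le> ereal (1 / real l) * ?T
        \<longleftrightarrow> 1 \<le> 1 / real l * (\<Sum>i=1..l. max (2 - 2 * (p i / \<alpha>)) 0)"
      by (simp add: one_ereal_def)
    then show ?thesis using False l by (simp add: field_simps)
  qed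
  show ?thesis
    unfolding F_EA_inf_def using assms by (subst Max_ge_iff) (auto simp: * simp del: One_nat_def)
qed

section \<open>Prefix means and the closed form of \<open>F'_EA\<close>\<close>

lemma sum_list_prefix_vec: "(\<Sum>x\<leftarrow>prefix_vec m p. f x) = (\<Sum>i=1..m. f (p i))"
  unfolding prefix_vec_def map_map interv_sum_list_conv_sum_set_nat
  by (simp add: atLeastLessThanSuc_atLeastAtMost del: upt_Suc)

lemma amean_prefix_vec: "amean (prefix_vec m p) = (\<Sum>i=1..m. p i) / real m"
  using sum_list_prefix_vec[of "\<lambda>x. x" m p] by (simp add: amean_def prefix_vec_def del: upt_Suc)

text \<open>Without positive parts the sum equals \<open>2 m - 2 m A / \<alpha>\<close>, with
  \<open>A\<close> the prefix mean, so the condition can be solved for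
  \<open>\<alpha>\<close>.\<close>

lemma sum_calibrator_ge_iff:
  assumes "0 < \<alpha>" "1 \<le> m"
  shows "real m \<le> (\<Sum>i=1..m. 2 - 2 * (p i / \<alpha>)) \<longleftrightarrow> 2 * amean (prefix_vec m p) \<le> \<alpha>"
proof -
  have "(\<Sum>i=1..m. 2 - 2 * (p i / \<alpha>)) = 2 * real m - 2 * (\<Sum>i=1..m. p i) / \<alpha>"
    by (simp add: sum_subtractf sum_divide_distrib sum_distrib_left)
  then show ?thesis unfolding amean_prefix_vec using assms by (simp only:) (simp add: field_simps)
qed

lemma amean_prefix_vec_nonneg:
  assumes "p \<in> cube K" "m \<le> K"
  shows "0 \<le> amean (prefix_vec m p)"
  unfolding amean_prefix_vec using cube_nonneg[OF assms(1)] assms(2)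
  by (intro divide_nonneg_nonneg sum_nonneg) auto

lemma F'_EA_closed_form:
  assumes K: "1 \<le> K" and p: "p \<in> cube K"
  shows "F'_EA K p = min 1 (2 * (MIN m\<in>{1..K}. amean (prefix_vec m p)))"
proof -
  let ?A = "MIN m\<in>{1..K}. amean (prefix_vec m p)"
  \<comment> \<open>Dividing by \<open>2\<close> isolates the minimum, which is at most a bound
    exactly when some prefix mean is.\<close>
  have le: "2 * ?A \<le> \<alpha> \<longleftrightarrow> (\<exists>m\<in>{1..K}. 2 * amean (prefix_vec m p) \<le> \<alpha>)" for \<alpha>
  proof -
    have "2 * ?A \<le> \<alpha> \<longleftrightarrow> ?A \<le> \<alpha> / 2" by auto
    also have "\<dots> \<longleftrightarrow> (\<exists>m\<in>{1..K}. amean (prefix_vec m p) \<le> \<alpha> / 2)"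
      using K by (subst Min_le_iff) auto
    also have "\<dots> \<longleftrightarrow> (\<exists>m\<in>{1..K}. 2 * amean (prefix_vec m p) \<le> \<alpha>)"
      by (intro bex_cong refl) auto
    finally show ?thesis .
  qed
  have "(\<exists>l\<in>{1..K}. real l \<le> (\<Sum>i=1..l. 2 - 2 * (p i / \<alpha>))) \<longleftrightarrow> 2 * ?A \<le> \<alpha>" if "0 < \<alpha>" for \<alpha>
    unfolding le
    by (intro bex_cong refl sum_calibrator_ge_iff that) simp
  then have "F'_EA K p = inf1 {\<alpha> \<in> {0<..<1}. 2 * ?A \<le> \<alpha>}"
    unfolding F'_EA_eq[OF K] by (intro arg_cong[of _ _ inf1] Collect_cong conj_cong refl) simp
  also have "0 \<le> ?A"
    using K by (subst Min_ge_iff) (auto intro!: amean_prefix_vec_nonneg[OF p])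
  then have "inf1 {\<alpha> \<in> {0<..<1}. 2 * ?A \<le> \<alpha>} = min 1 (2 * ?A)" by (intro inf1_ge) simp
  finally show ?thesis .
qed

text \<open>In threshold form the truncated \<open>F'_A\<close> is \<open>F'_EA\<close> with only
  the index \<open>l = K\<close> allowed. This makes it an instance of
  \<open>ex_p_merging_threshold\<close> and reduces its comparison with \<open>F'_EA\<close> to an
  inclusion of level sets.\<close>

lemma trunc1_F'_A_eq:
  assumes K: "1 \<le> K" and p: "p \<in> cube K"
  shows "trunc1 (F'_A K) p = inf1 {\<alpha> \<in> {0<..<1}. real K \<le> (\<Sum>i=1..K. 2 - 2 * (p i / \<alpha>))}"
proof -
  have "inf1 {\<alpha> \<in> {0<..<1}. real K \<le> (\<Sum>i=1..K. 2 - 2 * (p i / \<alpha>))}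
      = inf1 {\<alpha> \<in> {0<..<1}. F'_A K p \<le> \<alpha>}"
    using K by (intro arg_cong[of _ _ inf1]) (auto simp: F'_A_def sum_calibrator_ge_iff simp del: One_nat_def times_divide_eq_right)
  also have "\<dots> = trunc1 (F'_A K) p"
    unfolding trunc1_def using amean_prefix_vec_nonneg[OF p, of K] by (intro inf1_ge) (simp add: F'_A_def)
  finally show ?thesis by simp
qed

section \<open>The ex-p-merging property of the four functions\<close>

lemma measurable_calibrator_sums:
  assumes "l \<in> {1..K}"
  shows "{p \<in> space (cube_algebra K). real l \<le> (\<Sum>i=1..l. 2 - 2 * (p i / \<alpha>))} \<in> sets (cube_algebra K)"
    and "{p \<in> space (cube_algebra K). real l \<le> (\<Sum>i=1..l. max (2 - 2 * (p i / \<alpha>)) 0)} \<in> sets (cube_algebra K)"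
    and "{p \<in> space (cube_algebra K). \<exists>i\<in>{1..l}. p i = 0} \<in> sets (cube_algebra K)"
proof -
  have m: "(\<lambda>p. p i) \<in> borel_measurable (cube_algebra K)" if "i \<in> {1..l}" for i
    using that assms by (intro measurable_cube_component) auto
  have "(\<lambda>p. \<Sum>i=1..l. 2 - 2 * (p i / \<alpha>)) \<in> borel_measurable (cube_algebra K)"
    "(\<lambda>p. \<Sum>i=1..l. max (2 - 2 * (p i / \<alpha>)) 0) \<in> borel_measurable (cube_algebra K)"
    by (intro borel_measurable_sum borel_measurable_max borel_measurable_diff borel_measurable_times
        borel_measurable_divide borel_measurable_const m; assumption)+
  then show "{p \<in> space (cube_algebra K). real l \<le> (\<Sum>i=1..l. 2 - 2 * (p i / \<alpha>))} \<in> sets (cube_algebra K)"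
    "{p \<in> space (cube_algebra K). real l \<le> (\<Sum>i=1..l. max (2 - 2 * (p i / \<alpha>)) 0)} \<in> sets (cube_algebra K)"
    by measurable
  have "{p \<in> space (cube_algebra K). p i = 0} \<in> sets (cube_algebra K)" if "i \<in> {1..l}" for i
    using m[OF that] by measurable
  then show "{p \<in> space (cube_algebra K). \<exists>i\<in>{1..l}. p i = 0} \<in> sets (cube_algebra K)"
    by (intro sets.sets_Collect_finite_Ex) auto
qed

lemma real_le_sum_pos_part:
  fixes g :: "nat \<Rightarrow> real"
  assumes "c \<le> (\<Sum>i=1..l. g i)"
  shows "c \<le> (\<Sum>i=1..l. max (g i) 0)"
  using assms sum_mono[of "{1..l}" g "\<lambda>i. max (g i) 0"] by simp

lemma ex_p_merging_F_EA:
  assumes M: "prob_space M" and K: "1 \<le> K"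
  shows "ex_p_merging M K (F_EA K)"
proof (rule ex_p_merging_threshold[OF M K _ _ _ F_EA_eq[OF K]])
  show "\<exists>l\<in>{1..K}. real l \<le> (\<Sum>i=1..l. max (2 - 2 * (p i / \<beta>)) 0)"
    if nn: "\<And>i. i \<in> {1..K} \<Longrightarrow> 0 \<le> p i" and le: "\<And>i. i \<in> {1..K} \<Longrightarrow> p i \<le> q i"
      and \<alpha>: "0 < \<alpha>" "\<alpha> \<le> \<beta>" and Q: "\<exists>l\<in>{1..K}. real l \<le> (\<Sum>i=1..l. max (2 - 2 * (q i / \<alpha>)) 0)" for p q \<alpha> \<beta>
  proof -
    from Q obtain l where l: "l \<in> {1..K}" and Ql: "real l \<le> (\<Sum>i=1..l. max (2 - 2 * (q i / \<alpha>)) 0)" by blast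
    from l \<alpha> nn le Ql have "real l \<le> (\<Sum>i=1..l. max (2 - 2 * (p i / \<beta>)) 0)" by (rule calibrator_sum_mono)
    then show ?thesis using l by (rule bexI)
  qed
  show "{p \<in> space (cube_algebra K). \<exists>l\<in>{1..K}. real l \<le> (\<Sum>i=1..l. max (2 - 2 * (p i / \<alpha>)) 0)}
      \<in> sets (cube_algebra K)" for \<alpha>
    by (intro sets.sets_Collect_finite_Ex measurable_calibrator_sums finite_atLeastAtMost)
  show "\<exists>l\<in>{1..K}. of_nat l \<le> (\<Sum>i=1..l. calib \<alpha> (p i))"
    if "\<exists>l\<in>{1..K}. real l \<le> (\<Sum>i=1..l. max (2 - 2 * (p i / \<alpha>)) 0)" for p \<alpha>
    using that of_nat_le_sum_calib by blast
qed

lemma ex_p_merging_F_EA_inf: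
  assumes M: "prob_space M" and K: "1 \<le> K"
  shows "ex_p_merging M K (F_EA_inf K)"
proof (rule ex_p_merging_threshold[OF M K _ _ _ F_EA_inf_eq[OF K]])
  show "\<exists>l\<in>{1..K}. (\<exists>i\<in>{1..l}. p i = 0) \<or> real l \<le> (\<Sum>i=1..l. max (2 - 2 * (p i / \<beta>)) 0)"
    if nn: "\<And>i. i \<in> {1..K} \<Longrightarrow> 0 \<le> p i" and le: "\<And>i. i \<in> {1..K} \<Longrightarrow> p i \<le> q i"
      and \<alpha>: "0 < \<alpha>" "\<alpha> \<le> \<beta>" and Q: "\<exists>l\<in>{1..K}. (\<exists>i\<in>{1..l}. q i = 0) \<or> real l \<le> (\<Sum>i=1..l. max (2 - 2 * (q i / \<alpha>)) 0)" for p q \<alpha> \<beta>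
  proof -
    from Q obtain l where l: "l \<in> {1..K}"
      and Ql: "(\<exists>i\<in>{1..l}. q i = 0) \<or> real l \<le> (\<Sum>i=1..l. max (2 - 2 * (q i / \<alpha>)) 0)"
      by blast
    \<comment> \<open>From \<open>0 \<le> p i \<le> q i\<close>, a zero of \<open>q\<close> is a
      zero of \<open>p\<close>, so the zero case is also inherited by smaller vectors.\<close>
    have zero: "p i = 0" if "q i = 0" "i \<in> {1..l}" for i
      using nn[of i] le[of i] that l by simp
    from Ql have "(\<exists>i\<in>{1..l}. p i = 0) \<or> real l \<le> (\<Sum>i=1..l. max (2 - 2 * (p i / \<beta>)) 0)"
    proof
      assume "\<exists>i\<in>{1..l}. q i = 0"
      then show ?thesis using zero by blast
    next
      assume "real l \<le> (\<Sum>i=1..l. max (2 - 2 * (q i / \<alpha>)) 0)"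
      with l \<alpha> nn le have "real l \<le> (\<Sum>i=1..l. max (2 - 2 * (p i / \<beta>)) 0)"
        by (rule calibrator_sum_mono)
      then show ?thesis ..
    qed
    then show ?thesis using l by (rule bexI)
  qed
  show "{p \<in> space (cube_algebra K). \<exists>l\<in>{1..K}. (\<exists>i\<in>{1..l}. p i = 0) \<or>
      real l \<le> (\<Sum>i=1..l. max (2 - 2 * (p i / \<alpha>)) 0)} \<in> sets (cube_algebra K)" for \<alpha>
    by (intro sets.sets_Collect_finite_Ex[of "{1..K}"] sets.sets_Collect_disj measurable_calibrator_sums
        finite_atLeastAtMost)
  show "\<exists>l\<in>{1..K}. of_nat l \<le> (\<Sum>i=1..l. calib \<alpha> (p i))"
    if "\<exists>l\<in>{1..K}. (\<exists>i\<in>{1..l}. p i = 0) \<or> real l \<le> (\<Sum>i=1..l. max (2 - 2 * (p i / \<alpha>)) 0)" for p \<alpha>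
  proof -
    from that obtain l where l: "l \<in> {1..K}"
      "(\<exists>i\<in>{1..l}. p i = 0) \<or> real l \<le> (\<Sum>i=1..l. max (2 - 2 * (p i / \<alpha>)) 0)"
      by blast
    from l(2) have "of_nat l \<le> (\<Sum>i=1..l. calib \<alpha> (p i))"
    proof
      assume "\<exists>i\<in>{1..l}. p i = 0"
      then obtain i where "i \<in> {1..l}" "p i = 0" by blast
      then show ?thesis by (simp only: sum_calib_zero infinity_ennreal_def top_greatest)
    qed (rule of_nat_le_sum_calib)
    then show ?thesis using l(1) by (rule bexI)
  qed
qed

lemma ex_p_merging_F'_EA:
  assumes M: "prob_space M" and K: "1 \<le> K"
  shows "ex_p_merging M K (F'_EA K)"
proof (rule ex_p_merging_threshold[OF M K _ _ _ F'_EA_eq[OF K]])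
  show "\<exists>l\<in>{1..K}. real l \<le> (\<Sum>i=1..l. 2 - 2 * (p i / \<beta>))"
    if nn: "\<And>i. i \<in> {1..K} \<Longrightarrow> 0 \<le> p i" and le: "\<And>i. i \<in> {1..K} \<Longrightarrow> p i \<le> q i"
      and \<alpha>: "0 < \<alpha>" "\<alpha> \<le> \<beta>" and Q: "\<exists>l\<in>{1..K}. real l \<le> (\<Sum>i=1..l. 2 - 2 * (q i / \<alpha>))" for p q \<alpha> \<beta>
  proof -
    from Q obtain l where l: "l \<in> {1..K}" and Ql: "real l \<le> (\<Sum>i=1..l. 2 - 2 * (q i / \<alpha>))" by blast
    from l \<alpha> nn le Ql have "real l \<le> (\<Sum>i=1..l. 2 - 2 * (p i / \<beta>))" by (rule calibrator_sum_mono)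
    then show ?thesis using l by (rule bexI)
  qed
  show "{p \<in> space (cube_algebra K). \<exists>l\<in>{1..K}. real l \<le> (\<Sum>i=1..l. 2 - 2 * (p i / \<alpha>))}
      \<in> sets (cube_algebra K)" for \<alpha>
    by (intro sets.sets_Collect_finite_Ex measurable_calibrator_sums finite_atLeastAtMost)
  show "\<exists>l\<in>{1..K}. of_nat l \<le> (\<Sum>i=1..l. calib \<alpha> (p i))"
    if "\<exists>l\<in>{1..K}. real l \<le> (\<Sum>i=1..l. 2 - 2 * (p i / \<alpha>))" for p \<alpha>
    using that of_nat_le_sum_calib[OF real_le_sum_pos_part] by blast
qed

lemma ex_p_merging_trunc1_F'_A:
  assumes M: "prob_space M" and K: "1 \<le> K"
  shows "ex_p_merging M K (trunc1 (F'_A K))"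
proof (rule ex_p_merging_threshold[OF M K _ _ _ trunc1_F'_A_eq[OF K]])
  have KK: "K \<in> {1..K}" using K by simp
  show "real K \<le> (\<Sum>i=1..K. 2 - 2 * (p i / \<beta>))"
    if nn: "\<And>i. i \<in> {1..K} \<Longrightarrow> 0 \<le> p i" and le: "\<And>i. i \<in> {1..K} \<Longrightarrow> p i \<le> q i"
      and \<alpha>: "0 < \<alpha>" "\<alpha> \<le> \<beta>" and Q: "real K \<le> (\<Sum>i=1..K. 2 - 2 * (q i / \<alpha>))" for p q \<alpha> \<beta>
    using KK \<alpha> nn le Q by (rule calibrator_sum_mono)
  show "{p \<in> space (cube_algebra K). real K \<le> (\<Sum>i=1..K. 2 - 2 * (p i / \<alpha>))}
      \<in> sets (cube_algebra K)" for \<alpha>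
    by (intro measurable_calibrator_sums KK)
  show "\<exists>l\<in>{1..K}. of_nat l \<le> (\<Sum>i=1..l. calib \<alpha> (p i))"
    if "real K \<le> (\<Sum>i=1..K. 2 - 2 * (p i / \<alpha>))" for p \<alpha>
    using of_nat_le_sum_calib[OF real_le_sum_pos_part[OF that]] KK by (rule bexI)
qed

subsection \<open>Dominations\<close>

text \<open>Taking positive parts can only raise the sums, hence enlarges the set of admissible
  levels and lowers its infimum.\<close>

lemma F_EA_le_F'_EA:
  assumes "1 \<le> K"
  shows "F_EA K p \<le> F'_EA K p"
  unfolding F_EA_eq[OF assms] F'_EA_eq[OF assms]
  by (intro inf1_antimono) (auto intro!: real_le_sum_pos_part simp del: One_nat_def)

lemma F_EA_inf_le_F_EA:
  assumes "1 \<le> K"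
  shows "F_EA_inf K p \<le> F_EA K p"
  unfolding F_EA_eq[OF assms] F_EA_inf_eq[OF assms]
  by (intro inf1_antimono) auto

lemma F'_EA_le_trunc1_F'_A:
  assumes "1 \<le> K" "p \<in> cube K"
  shows "F'_EA K p \<le> trunc1 (F'_A K) p"
  unfolding F'_EA_eq[OF assms(1)] trunc1_F'_A_eq[OF assms] using assms(1)
  by (intro inf1_antimono) auto

lemma inf1_eq_0: "inf1 {\<alpha> \<in> {0<..<1}. Q \<alpha>} = 0" if "\<And>\<alpha>. \<alpha> \<in> {0<..<1} \<Longrightarrow> Q \<alpha>"
proof -
  have "{\<alpha> \<in> {0<..<1}. Q \<alpha>} = {\<alpha> \<in> {0<..<1}. 0 \<le> \<alpha>}" using that by auto
  then show ?thesis using inf1_ge[of 0] by simp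
qed

text \<open>A zero component contributes \<open>2\<close> to the sum, which reaches \<open>l\<close>
  at every level as long as \<open>l \<le> 2\<close>. A zero at index \<open>3\<close> would give
  \<open>2\<close> against a required \<open>3\<close>; this is why the closed form holds at zeros
  for \<open>K = 2\<close> but not for larger \<open>K\<close>.\<close>

lemma F_EA_eq_0:
  assumes K: "2 \<le> K" and p: "p \<in> cube K" and 0: "p 1 = 0 \<or> p 2 = 0"
  shows "F_EA K p = 0"
proof -
  have K1: "1 \<le> K" using K by simp
  have ex: "\<exists>l\<in>{1..K}. real l \<le> (\<Sum>i=1..l. max (2 - 2 * (p i / \<alpha>)) 0)" for \<alpha>
    using 0
  proof
    assume "p 1 = 0"
    then show ?thesis using K by (intro bexI[of _ 1]) auto
  next
    assume "p 2 = 0"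
    then show ?thesis using K by (intro bexI[of _ 2]) (auto simp: numeral_2_eq_2)
  qed
  show ?thesis unfolding F_EA_eq[OF K1] by (intro inf1_eq_0 ex)
qed

lemma strictly_dominates_F_EA:
  assumes K: "2 \<le> K"
  shows "strictly_dominates K (F_EA K) (F'_EA K)"
proof -
  \<comment> \<open>At \<open>(1, 0, 1, ..., 1)\<close> the prefix means are \<open>1\<close> for
    \<open>m = 1\<close> and \<open>(m - 1) / m \<ge> 1 / 2\<close> afterwards, so
    \<open>F'_EA\<close> is \<open>1\<close>. For \<open>F_EA\<close> the positive part discards the
    negative term of the first component, and the zero at index \<open>2\<close> gives the value
    \<open>0\<close>.\<close>
  define p :: "nat \<Rightarrow> real" where "p = (\<lambda>i\<in>{1..K}. if i = 2 then 0 else 1)"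
  have p: "p \<in> cube K" by (auto simp: p_def)
  have sum: "(\<Sum>i=1..m. if i = 2 then 0 else 1) = (if m < 2 then real m else real m - 1)" for m :: nat
    by (induction m) auto
  have "1 / 2 \<le> amean (prefix_vec m p)" if m: "m \<in> {1..K}" for m
  proof -
    have "(\<Sum>i=1..m. p i) = (\<Sum>i=1..m. if i = 2 then 0 else 1)"
      using m by (intro sum.cong) (auto simp: p_def)
    then show ?thesis using m unfolding amean_prefix_vec sum by (auto simp: field_simps)
  qed
  then have "1 / 2 \<le> (MIN m\<in>{1..K}. amean (prefix_vec m p))"
    using K by (subst Min_ge_iff) auto
  then have "F'_EA K p = 1" using K F'_EA_closed_form[of K p] p by auto
  moreover have "F_EA K p = 0" using K p by (intro F_EA_eq_0) (auto simp: p_def)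
  ultimately show ?thesis
    using K p F_EA_le_F'_EA[of K] by (auto simp: strictly_dominates_def dominates_def intro!: bexI[of _ p])
qed

lemma strictly_dominates_trans_left:
  assumes "dominates K F G" "strictly_dominates K G H"
  shows "strictly_dominates K F H"
  using assms unfolding strictly_dominates_def dominates_def by (meson order_trans le_less_trans)

lemma strictly_dominates_trans_right:
  assumes "strictly_dominates K F G" "dominates K G H"
  shows "strictly_dominates K F H"
  using assms unfolding strictly_dominates_def dominates_def by (meson order_trans less_le_trans)

lemma strictly_dominates_F'_EA:
  assumes K: "2 \<le> K"
  shows "strictly_dominates K (F'_EA K) (trunc1 (F'_A K))"
proof -
  \<comment> \<open>At \<open>(0, 1, ..., 1)\<close> the prefix of length \<open>1\<close> already
    has mean \<open>0\<close>, while the mean of the whole vector is positive.\<close>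
  define p :: "nat \<Rightarrow> real" where "p = (\<lambda>i\<in>{1..K}. if i = 1 then 0 else 1)"
  have p: "p \<in> cube K" by (auto simp: p_def)
  have "p 1 = 0" using K by (simp add: p_def)
  then have ex: "\<exists>l\<in>{1..K}. real l \<le> (\<Sum>i=1..l. 2 - 2 * (p i / \<alpha>))" for \<alpha>
    using K by (intro bexI[of _ 1]) auto
  have K1: "1 \<le> K" using K by simp
  have "F'_EA K p = 0" unfolding F'_EA_eq[OF K1] by (intro inf1_eq_0 ex)
  moreover have "0 < trunc1 (F'_A K) p"
  proof -
    have "p 2 \<le> (\<Sum>i=1..K. p i)" using K p cube_nonneg[OF p] by (intro member_le_sum) auto
    then show ?thesis using K by (simp add: trunc1_def F'_A_def amean_prefix_vec p_def)
  qed
  ultimately show ?thesis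
    using K p F'_EA_le_trunc1_F'_A[of K] by (auto simp: strictly_dominates_def dominates_def intro!: bexI[of _ p])
qed

subsection \<open>The closed form\<close>

text \<open>Along a sorted list an antitone function is first non-negative and then negative, so
  taking positive parts amounts to dropping a tail.\<close>

lemma sum_pos_part_eq_prefix:
  fixes f :: "'b::linorder \<Rightarrow> real"
  assumes "antimono f" "sorted xs"
  shows "\<exists>m\<le>length xs. (\<Sum>x\<leftarrow>xs. max (f x) 0) = (\<Sum>x\<leftarrow>take m xs. f x)"
  using assms(2)
proof (induction xs)
  case (Cons x xs)
  show ?case
  proof (cases "0 \<le> f x")
    case True
    obtain m where "m \<le> length xs" "(\<Sum>x\<leftarrow>xs. max (f x) 0) = (\<Sum>x\<leftarrow>take m xs. f x)"
      using Cons by auto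
    then show ?thesis using True by (intro exI[of _ "Suc m"]) auto
  next
    case False
    have "max (f y) 0 = 0" if "y \<in> set (x # xs)" for y
      using that Cons.prems False antimonoD[OF assms(1), of x y] by auto
    then have "map (\<lambda>x. max (f x) 0) (x # xs) = map (\<lambda>x. 0) (x # xs)" by (intro map_cong) auto
    then have "(\<Sum>x\<leftarrow>x # xs. max (f x) 0) = 0" by (simp only: sum_list_0)
    then show ?thesis by (intro exI[of _ 0]) auto
  qed
qed auto

text \<open>The sum of positive parts bounds every prefix sum and equals one of them. Positivity of
  \<open>c\<close> rules out the empty prefix, so \<open>m\<close> may start at
  \<open>1\<close>.\<close>

lemma sum_pos_part_ge_iff_prefix:
  fixes f :: "'b::linorder \<Rightarrow> real"
  assumes "antimono f" "sorted xs" "0 < c"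
  shows "c \<le> (\<Sum>x\<leftarrow>xs. max (f x) 0) \<longleftrightarrow> (\<exists>m\<in>{1..length xs}. c \<le> (\<Sum>x\<leftarrow>take m xs. f x))"
proof
  assume c: "c \<le> (\<Sum>x\<leftarrow>xs. max (f x) 0)"
  obtain m where m: "m \<le> length xs" "(\<Sum>x\<leftarrow>xs. max (f x) 0) = (\<Sum>x\<leftarrow>take m xs. f x)"
    using sum_pos_part_eq_prefix[OF assms(1,2)] by blast
  have "m \<noteq> 0" using c m \<open>0 < c\<close> by (intro notI) auto
  then show "\<exists>m\<in>{1..length xs}. c \<le> (\<Sum>x\<leftarrow>take m xs. f x)" using c m by (intro bexI[of _ m]) auto
next
  assume "\<exists>m\<in>{1..length xs}. c \<le> (\<Sum>x\<leftarrow>take m xs. f x)"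
  then obtain m where "c \<le> (\<Sum>x\<leftarrow>take m xs. f x)" by blast
  also have "\<dots> \<le> (\<Sum>x\<leftarrow>take m xs. max (f x) 0)" by (intro sum_list_mono) auto
  also have "\<dots> \<le> (\<Sum>x\<leftarrow>take m xs. max (f x) 0) + (\<Sum>x\<leftarrow>drop m xs. max (f x) 0)"
    by (auto intro!: sum_list_nonneg)
  also have "\<dots> = (\<Sum>x\<leftarrow>xs. max (f x) 0)"
    by (simp flip: sum_list_append map_append)
  finally show "c \<le> (\<Sum>x\<leftarrow>xs. max (f x) 0)" .
qed

lemma length_smallest_vec: "m \<le> l \<Longrightarrow> length (smallest_vec l m p) = m"
  by (simp add: smallest_vec_def prefix_vec_def)

lemma set_smallest_vec: "set (smallest_vec l m p) \<subseteq> p ` {1..l}"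
  using set_take_subset[of m "sort (prefix_vec l p)"]
  by (auto simp: smallest_vec_def prefix_vec_def simp del: upt_Suc)

text \<open>Strict positivity settles the indices where \<open>(2 - l / m)_+\<close> vanishes: there
  the inequality solved for \<open>\<alpha>\<close> has to fail, in agreement with an infinite
  quotient.\<close>

lemma amean_smallest_vec_pos:
  assumes "m \<in> {1..l}" "\<And>i. i \<in> {1..l} \<Longrightarrow> 0 < p i"
  shows "0 < amean (smallest_vec l m p)"
proof -
  have len: "length (smallest_vec l m p) = m" using assms(1) by (simp add: length_smallest_vec)
  have pos: "0 < x" if "x \<in> set (smallest_vec l m p)" for x
    using set_smallest_vec that assms(2) by fastforce
  obtain y ys where ys: "smallest_vec l m p = y # ys"
    using len assms(1) by (cases "smallest_vec l m p") auto
  have "0 < y" "0 \<le> sum_list ys"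
    using ys pos by (auto intro!: sum_list_nonneg intro: less_imp_le)
  then have "0 < sum_list (smallest_vec l m p)" by (simp add: ys)
  then show ?thesis using len assms(1) by (simp add: amean_def)
qed

text \<open>After sorting, the positive parts reduce to prefixes of the \<open>m\<close> smallest
  entries. Each prefix condition is linear and rearranges to
  \<open>2 A \<le> \<alpha> (2 - l / m)\<close>, which is the bound on the quotient with indices
  \<open>l\<close> and \<open>m\<close>.\<close>

lemma sum_pos_part_ge_iff_div_inf:
  assumes \<alpha>: "0 < \<alpha>" and l: "1 \<le> l" and pos: "\<And>i. i \<in> {1..l} \<Longrightarrow> 0 < p i"
  shows "real l \<le> (\<Sum>i=1..l. max (2 - 2 * (p i / \<alpha>)) 0) \<longleftrightarrow>
    (\<exists>m\<in>{1..l}. div_inf (2 * amean (smallest_vec l m p)) (max (2 - real l / real m) 0) \<le> ereal \<alpha>)"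
proof -
  let ?f = "\<lambda>x. 2 - 2 * (x / \<alpha>)"
  let ?xs = "sort (prefix_vec l p)"
  have anti: "antimono ?f" using \<alpha> by (intro antimonoI) (simp add: divide_right_mono)
  have len: "length ?xs = l" by (simp add: prefix_vec_def)
  \<comment> \<open>The sum depends only on the multiset of entries, hence is unchanged by
    sorting.\<close>
  have "mset (map (\<lambda>x. max (?f x) 0) ?xs) = mset (map (\<lambda>x. max (?f x) 0) (prefix_vec l p))"
    by simp
  then have "(\<Sum>i=1..l. max (?f (p i)) 0) = (\<Sum>x\<leftarrow>?xs. max (?f x) 0)"
    using sum_list_prefix_vec[of "\<lambda>x. max (?f x) 0" l p] by (metis sum_mset_sum_list)
  moreover have "real l \<le> (\<Sum>x\<leftarrow>take m ?xs. ?f x) \<longleftrightarrow>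
      div_inf (2 * amean (smallest_vec l m p)) (max (2 - real l / real m) 0) \<le> ereal \<alpha>"
    if m: "m \<in> {1..l}" for m
  proof -
    let ?A = "amean (smallest_vec l m p)"
    have lenm: "length (smallest_vec l m p) = m" using m by (simp add: length_smallest_vec)
    have A: "0 < ?A" using m pos by (rule amean_smallest_vec_pos)
    have "(\<Sum>x\<leftarrow>ys. ?f x) = 2 * real (length ys) - 2 * sum_list ys / \<alpha>" for ys
      by (induction ys) (auto simp: field_simps add_divide_distrib)
    then have "(\<Sum>x\<leftarrow>take m ?xs. ?f x) = 2 * real m - 2 * (real m * ?A) / \<alpha>"
      using lenm m by (simp add: amean_def flip: smallest_vec_def)
    then have "real l \<le> (\<Sum>x\<leftarrow>take m ?xs. ?f x) \<longleftrightarrow> 2 * ?A \<le> \<alpha> * (2 - real l / real m)"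
      using m \<alpha> by (simp only:) (simp add: field_simps)
    also have "\<dots> \<longleftrightarrow> div_inf (2 * ?A) (max (2 - real l / real m) 0) \<le> ereal \<alpha>"
    proof (cases "0 < 2 - real l / real m")
      case True
      then have "max (2 - real l / real m) 0 = 2 - real l / real m" by simp
      then show ?thesis using True by (simp add: div_inf_def pos_divide_le_eq)
    next
      case False
      \<comment> \<open>With a non-positive factor the right-hand side cannot reach
        \<open>2 A > 0\<close>, and \<open>div_inf\<close> is infinite: both sides are
        false.\<close>
      then have "\<alpha> * (2 - real l / real m) \<le> 0" using \<alpha> by (intro mult_nonneg_nonpos) auto
      then show ?thesis using False A by (simp add: div_inf_def max_def)
    qed
    finally show ?thesis .
  qed
  ultimately show ?thesis
    using sum_pos_part_ge_iff_prefix[OF anti sorted_sort, of "real l" "prefix_vec l p"] l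
    by (simp add: len del: One_nat_def) (auto simp: prefix_vec_def)
qed

text \<open>The nested minimum is at most \<open>\<alpha>\<close> exactly when some quotient is,
  which is the threshold condition of \<open>F_EA\<close>. The truncation is then supplied by
  \<open>ereal_inf1_ge\<close>.\<close>

lemma F_EA_closed_form_pos:
  assumes K: "1 \<le> K" and pos: "0 < Min (p ` {1..K})"
  shows "ereal (F_EA K p) = min 1 (EA_closed_form K p)"
proof -
  let ?d = "\<lambda>l m. div_inf (2 * amean (smallest_vec l m p)) (max (2 - real l / real m) 0)"
  have p: "0 < p i" if "i \<in> {1..K}" for i
    using pos that K by (subst (asm) Min_gr_iff) auto
  have C: "EA_closed_form K p = (MIN l\<in>{1..K}. MIN m\<in>{1..l}. ?d l m)"
    using pos by (simp add: EA_closed_form_def)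
  have le: "EA_closed_form K p \<le> c \<longleftrightarrow> (\<exists>l\<in>{1..K}. \<exists>m\<in>{1..l}. ?d l m \<le> c)" for c
    using K unfolding C by (auto simp: Min_le_iff)
  have "0 \<le> ?d l m" if "l \<in> {1..K}" "m \<in> {1..l}" for l m
    using amean_smallest_vec_pos[OF that(2), of p] p that by (auto simp: div_inf_def)
  then have nonneg: "0 \<le> EA_closed_form K p"
    using K unfolding C by (subst Min_ge_iff; auto simp: Min_ge_iff)
  have "(\<exists>l\<in>{1..K}. real l \<le> (\<Sum>i=1..l. max (2 - 2 * (p i / \<alpha>)) 0)) \<longleftrightarrow> EA_closed_form K p \<le> ereal \<alpha>"
    if "0 < \<alpha>" for \<alpha>
    unfolding le by (intro bex_cong refl sum_pos_part_ge_iff_div_inf that) (auto intro: p)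
  then have "F_EA K p = inf1 {\<alpha> \<in> {0<..<1}. EA_closed_form K p \<le> ereal \<alpha>}"
    unfolding F_EA_eq[OF K] by (intro arg_cong[of _ _ inf1]) auto
  then show ?thesis using ereal_inf1_ge[OF nonneg] by simp
qed

lemma EA_closed_form_zero:
  assumes "\<not> 0 < Min (p ` {1..K})"
  shows "EA_closed_form K p = 0"
  using assms by (simp add: EA_closed_form_def)

lemma cube_has_zero:
  assumes "1 \<le> K" "p \<in> cube K" "\<not> 0 < Min (p ` {1..K})"
  obtains i where "i \<in> {1..K}" "p i = 0"
proof -
  have "Min (p ` {1..K}) \<in> p ` {1..K}" using assms(1) by (intro Min_in) auto
  then obtain i where "i \<in> {1..K}" "Min (p ` {1..K}) = p i" by blast
  then show thesis using that cube_nonneg[OF assms(2)] assms(3) by force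
qed

text \<open>For positive components the two conventions at \<open>0\<close> coincide. If a component
  vanishes, every level is admissible, and the infimum \<open>0\<close> matches the indicator in the
  closed form.\<close>

lemma F_EA_inf_closed_form:
  assumes K: "1 \<le> K" and p: "p \<in> cube K"
  shows "ereal (F_EA_inf K p) = min 1 (EA_closed_form K p)"
proof (cases "0 < Min (p ` {1..K})")
  case True
  then have "p i \<noteq> 0" if "i \<in> {1..K}" for i
    using that K by (subst (asm) Min_gr_iff) force+
  then have "F_EA_inf K p = F_EA K p"
    unfolding F_EA_eq[OF K] F_EA_inf_eq[OF K] by (intro arg_cong[of _ _ inf1]) auto
  then show ?thesis using F_EA_closed_form_pos[OF K True] by simp
next
  case False
  then obtain i where "i \<in> {1..K}" "p i = 0" using cube_has_zero[OF K p] by blast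
  moreover have "K \<in> {1..K}" using K by simp
  ultimately have ex: "\<exists>l\<in>{1..K}. (\<exists>i\<in>{1..l}. p i = 0) \<or>
      real l \<le> (\<Sum>i=1..l. max (2 - 2 * (p i / \<alpha>)) 0)" for \<alpha>
    by blast
  have "F_EA_inf K p = 0"
    unfolding F_EA_inf_eq[OF K] by (intro inf1_eq_0 ex)
  then show ?thesis using EA_closed_form_zero[OF False] by (simp add: min_def)
qed

theorem theorem6p2:
  fixes M :: "'a measure" and K :: nat
  assumes "atomless_prob_space M" and "K \<ge> 2"
  shows "ex_p_merging M K (F_EA K)
     \<and> ex_p_merging M K (F_EA_inf K)
     \<and> ex_p_merging M K (F'_EA K)
     \<and> ex_p_merging M K (trunc1 (F'_A K))
     \<and> strictly_dominates K (F_EA K) (F'_EA K)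
     \<and> strictly_dominates K (F_EA_inf K) (F'_EA K)
     \<and> strictly_dominates K (F'_EA K) (trunc1 (F'_A K))
     \<and> strictly_dominates K (F'_EA K) (F'_A K)
     \<and> (\<forall>p\<in>cube K. F'_EA K p = min 1 (2 * (MIN m\<in>{1..K}. amean (prefix_vec m p))))
     \<and> (\<forall>p\<in>cube K. K = 2 \<or> Min (p ` {1..K}) > 0 \<longrightarrow> ereal (F_EA K p) = min 1 (EA_closed_form K p))
     \<and> (\<forall>p\<in>cube K. ereal (F_EA_inf K p) = min 1 (EA_closed_form K p))"
proof (intro conjI ballI impI)
  have M: "prob_space M" and K: "1 \<le> K"
    using assms by (auto simp: atomless_prob_space_def)
  show "ex_p_merging M K (F_EA K)" "ex_p_merging M K (F_EA_inf K)"
    "ex_p_merging M K (F'_EA K)" "ex_p_merging M K (trunc1 (F'_A K))"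
    by (fact ex_p_merging_F_EA[OF M K] ex_p_merging_F_EA_inf[OF M K]
        ex_p_merging_F'_EA[OF M K] ex_p_merging_trunc1_F'_A[OF M K])+
  show "strictly_dominates K (F_EA K) (F'_EA K)" using assms(2) by (rule strictly_dominates_F_EA)
  then show "strictly_dominates K (F_EA_inf K) (F'_EA K)"
    by (rule strictly_dominates_trans_left[rotated])
      (use F_EA_inf_le_F_EA[OF K] in \<open>auto simp: dominates_def\<close>)
  show "strictly_dominates K (F'_EA K) (trunc1 (F'_A K))"
    using assms(2) by (rule strictly_dominates_F'_EA)
  \<comment> \<open>Truncation only lowers values, so the witness for the truncated mean serves the
    untruncated one as well.\<close>
  then show "strictly_dominates K (F'_EA K) (F'_A K)"
    by (rule strictly_dominates_trans_right) (auto simp: dominates_def trunc1_def)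
  fix p assume p: "p \<in> cube K"
  show "F'_EA K p = min 1 (2 * (MIN m\<in>{1..K}. amean (prefix_vec m p)))"
    using K p by (rule F'_EA_closed_form)
  show "ereal (F_EA_inf K p) = min 1 (EA_closed_form K p)"
    using K p by (rule F_EA_inf_closed_form)
  assume "K = 2 \<or> 0 < Min (p ` {1..K})"
  then show "ereal (F_EA K p) = min 1 (EA_closed_form K p)"
  proof (cases "0 < Min (p ` {1..K})")
    case True
    then show ?thesis by (rule F_EA_closed_form_pos[OF K])
  next
    case False
    then obtain i where i: "i \<in> {1..K}" "p i = 0" using cube_has_zero[OF K p] by blast
    \<comment> \<open>Only \<open>K = 2\<close> remains here, which forces the zero to index
      \<open>1\<close> or \<open>2\<close>, within reach of \<open>F_EA_eq_0\<close>.\<close>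
    moreover have "K = 2" using False \<open>K = 2 \<or> _\<close> by blast
    ultimately have "i = 1 \<or> i = 2" by auto
    then have "F_EA K p = 0" using i by (intro F_EA_eq_0 assms(2) p) auto
    then show ?thesis using EA_closed_form_zero[OF False] by (simp add: min_def)
  qed
qed

end
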